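(* For all graphs $G$ and $H$, $$\operatorname{sbn}(G\,\square\, H)\geq \operatorname{sbn}(G)\operatorname{sbn}(H).$$
   Context: All graphs are simple, finite and undirected. A set $A\subseteq V(G)$ is connected in $G$ if the induced subgraph $G[A]$ is connected. A strict bramble in $G$ is a collection $\mathscr{S}$ of non-empty connected subsets of $V(G)$ that pairwise intersect. A hitting set for $\mathscr{S}$ is a set $S\subseteq V(G)$ that intersects every element of $\mathscr{S}$; the order of $\mathscr{S}$ is the minimum size of a hitting set for $\mathscr{S}$. The strict bramble number $\operatorname{sbn}(G)$ is the maximum order of a strict bramble in $G$. The Cartesian product $G\,\square\, H$ is the graph with vertex set $V(G)\times V(H)$, where $(g_1,h_1)(g_2,h_2)$ is an edge if and only if $g_1=g_2$ and $h_1h_2\in E(H)$; or $g_1g_2\in E(G)$ and $h_1=h_2$. *)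

theory Defs
  imports "Graph_Theory.Graph_Theory"
begin

text \<open>
  A finite simple undirected graph is a \<^locale>\<open>pair_graph\<close>: finite, loop-free, without parallel
  arcs, and with a symmetric arc relation, so that an undirected edge is represented by its two
  orientations. The graph without vertices is included.
\<close>

definition connected_set :: "'a pair_pre_digraph \<Rightarrow> 'a set \<Rightarrow> bool" where
  "connected_set G A \<longleftrightarrow> A \<subseteq> pverts G \<and> connected (with_proj G \<restriction> A)"

definition strict_bramble :: "'a pair_pre_digraph \<Rightarrow> 'a set set \<Rightarrow> bool" where
  "strict_bramble G \<S> \<longleftrightarrow>
     (\<forall>A\<in>\<S>. A \<noteq> {} \<and> connected_set G A) \<and> (\<forall>A\<in>\<S>. \<forall>B\<in>\<S>. A \<inter> B \<noteq> {})"

definition hitting_set :: "'a pair_pre_digraph \<Rightarrow> 'a set set \<Rightarrow> 'a set \<Rightarrow> bool" where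
  "hitting_set G \<S> S \<longleftrightarrow> S \<subseteq> pverts G \<and> (\<forall>A\<in>\<S>. S \<inter> A \<noteq> {})"

definition bramble_order :: "'a pair_pre_digraph \<Rightarrow> 'a set set \<Rightarrow> nat" where
  "bramble_order G \<S> = Min {card S | S. hitting_set G \<S> S}"

definition sbn :: "'a pair_pre_digraph \<Rightarrow> nat" where
  "sbn G = Max {bramble_order G \<S> | \<S>. strict_bramble G \<S>}"

definition cartesian_product ::
    "'a pair_pre_digraph \<Rightarrow> 'b pair_pre_digraph \<Rightarrow> ('a \<times> 'b) pair_pre_digraph"
    (infixl "\<box>" 70) where
  "G \<box> H = \<lparr> pverts = pverts G \<times> pverts H,
     parcs = {((g1, h1), (g2, h2)) | g1 h1 g2 h2.
       (g1, h1) \<in> pverts G \<times> pverts H \<and> (g2, h2) \<in> pverts G \<times> pverts H \<and>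
       (g1 = g2 \<and> (h1, h2) \<in> parcs H \<or> (g1, g2) \<in> parcs G \<and> h1 = h2)} \<rparr>"

text \<open>
  The minimum and the maximum above are taken over finite non-empty sets, and products of graphs
  are graphs.
\<close>

lemma pair_graph_cartesian_product:
  assumes "pair_graph G" "pair_graph H"
  shows "pair_graph (G \<box> H)"
proof -
  interpret G: pair_graph G by fact
  interpret H: pair_graph H by fact
  have fin: "finite (parcs (G \<box> H))"
    by (rule finite_subset[of _ "(pverts G \<times> pverts H) \<times> (pverts G \<times> pverts H)"])
      (auto simp: cartesian_product_def G.pair_finite_verts H.pair_finite_verts)
  have sG: "(v, u) \<in> parcs G" if "(u, v) \<in> parcs G" for u v
    using G.pair_sym_arcs that by (auto simp: symmetric_def dest: symD)
  have sH: "(v, u) \<in> parcs H" if "(u, v) \<in> parcs H" for u v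
    using H.pair_sym_arcs that by (auto simp: symmetric_def dest: symD)
  have sym: "sym (parcs (G \<box> H))"
    by (rule symI) (auto simp: cartesian_product_def intro: sG sH)
  show ?thesis
    using fin sym G.pair_no_loops H.pair_no_loops
    by unfold_locales
      (auto simp: cartesian_product_def symmetric_def G.pair_finite_verts H.pair_finite_verts)
qed

lemma hitting_set_cards:
  assumes "pair_graph G" "strict_bramble G \<S>"
  shows "finite {card S | S. hitting_set G \<S> S}" "{card S | S. hitting_set G \<S> S} \<noteq> {}"
proof -
  interpret pair_graph G by fact
  have "{card S | S. hitting_set G \<S> S} \<subseteq> card ` Pow (pverts G)"
    by (auto simp: hitting_set_def)
  then show "finite {card S | S. hitting_set G \<S> S}"
    by (rule finite_subset) (simp add: pair_finite_verts)
  have "hitting_set G \<S> (pverts G)"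
    using assms(2) by (fastforce simp: hitting_set_def strict_bramble_def connected_set_def)
  then show "{card S | S. hitting_set G \<S> S} \<noteq> {}" by blast
qed

lemma bramble_orders:
  assumes "pair_graph G"
  shows "finite {bramble_order G \<S> | \<S>. strict_bramble G \<S>}"
    "{bramble_order G \<S> | \<S>. strict_bramble G \<S>} \<noteq> {}"
proof -
  interpret pair_graph G by fact
  have "{bramble_order G \<S> | \<S>. strict_bramble G \<S>} \<subseteq> bramble_order G ` Pow (Pow (pverts G))"
    by (auto simp: strict_bramble_def connected_set_def)
  then show "finite {bramble_order G \<S> | \<S>. strict_bramble G \<S>}"
    by (rule finite_subset) (simp add: pair_finite_verts)
  have "strict_bramble G {}" by (simp add: strict_bramble_def)
  then show "{bramble_order G \<S> | \<S>. strict_bramble G \<S>} \<noteq> {}" by blast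
qed

end

theory Submission
  imports Defs
begin

text \<open>
  Let \<open>\<S>\<close> and \<open>\<T>\<close> be optimal strict brambles in \<open>G\<close> and \<open>H\<close>. The boxes \<open>A \<times> B\<close> do not suffice; instead
  attach to every vertex \<open>a\<close> of \<open>A \<in> \<S>\<close> its own element \<open>B a\<close> of \<open>\<T>\<close>. The union of the fibres
  \<open>{a} \<times> B a\<close> is connected, because the fibres over adjacent vertices of \<open>A\<close> share an element of \<open>H\<close>,
  and two such unions intersect over any common vertex of their bases. If \<open>X\<close> hits all of
  them, then the vertices whose fibre in \<open>X\<close> hits \<open>\<T>\<close> form a hitting set for \<open>\<S>\<close>: otherwise, over
  some \<open>A \<in> \<S>\<close> every \<open>B a\<close> could be chosen to avoid \<open>X\<close>.
\<close>

text \<open>The arc relation is symmetric already, so the symmetric closure inside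
  \<open>connected\<close> adds no arcs, and \<open>rtrancl_on A\<close> keeps every walk inside
  \<open>A\<close>, so restricting the arcs to \<open>A\<close> changes nothing. The non-emptiness
  comes from \<open>strongly_connected\<close>. In this form connectedness can be proved by
  induction along walks.\<close>

lemma connected_set_iff:
  assumes "pair_graph G"
  shows "connected_set G A \<longleftrightarrow>
    A \<subseteq> pverts G \<and> A \<noteq> {} \<and> (\<forall>u\<in>A. \<forall>v\<in>A. (u, v) \<in> rtrancl_on A (parcs G))"
proof -
  interpret pair_graph G by fact
  have "(v, u) \<in> parcs G" if "(u, v) \<in> parcs G" for u v
    using pair_sym_arcs that by (auto simp: symmetric_def dest: symD)
  then have parcs: "parcs (mk_symmetric (with_proj G \<restriction> A)) = parcs G \<inter> A \<times> A"
    by (auto simp: parcs_mk_symmetric)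
  have "(u, v) \<in> rtrancl_on A (parcs G \<inter> A \<times> A) \<longleftrightarrow> (u, v) \<in> rtrancl_on A (parcs G)" for u v
  proof
    show "(u, v) \<in> rtrancl_on A (parcs G)" if "(u, v) \<in> rtrancl_on A (parcs G \<inter> A \<times> A)"
      using that by (induction rule: rtrancl_on_induct) (auto intro: rtrancl_on_into_rtrancl_on)
    show "(u, v) \<in> rtrancl_on A (parcs G \<inter> A \<times> A)" if "(u, v) \<in> rtrancl_on A (parcs G)"
      using that by (induction rule: rtrancl_on_induct) (auto intro: rtrancl_on_into_rtrancl_on)
  qed
  then show ?thesis
    by (auto simp: connected_set_def connected_def strongly_connected_def reachable_def parcs)
qed

lemma connected_set_Sigma:
  assumes "pair_graph G" "pair_graph H"
    and A: "connected_set G A"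
    and B: "\<And>a. a \<in> A \<Longrightarrow> connected_set H (B a)"
    and meet: "\<And>a a'. a \<in> A \<Longrightarrow> a' \<in> A \<Longrightarrow> B a \<inter> B a' \<noteq> {}"
  shows "connected_set (G \<box> H) (Sigma A B)"
proof -
  have A_sub: "A \<subseteq> pverts G" and A_ne: "A \<noteq> {}"
    and A_conn: "\<And>u v. u \<in> A \<Longrightarrow> v \<in> A \<Longrightarrow> (u, v) \<in> rtrancl_on A (parcs G)"
    using A unfolding connected_set_iff[OF assms(1)] by blast+
  have B_sub: "B a \<subseteq> pverts H" and B_ne: "B a \<noteq> {}"
    and B_conn: "\<And>h k. h \<in> B a \<Longrightarrow> k \<in> B a \<Longrightarrow> (h, k) \<in> rtrancl_on (B a) (parcs H)"
    if "a \<in> A" for a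
    using B[OF that] unfolding connected_set_iff[OF assms(2)] by blast+
  let ?W = "Sigma A B"
  let ?R = "rtrancl_on ?W (parcs (G \<box> H))"
  \<comment> \<open>A walk inside \<open>B a\<close> lifts to the fibre over \<open>a\<close>, with
    the first coordinate fixed.\<close>
  have fibre: "((a, h), (a, k)) \<in> ?R" if a: "a \<in> A" and "h \<in> B a" "k \<in> B a" for a h k
    using B_conn[OF that]
  proof (induction rule: rtrancl_on_induct)
    case base
    then show ?case using a by auto
  next
    case (step y z)
    have "((a, y), (a, z)) \<in> parcs (G \<box> H)"
      using step.hyps a A_sub B_sub[OF a] by (auto simp: cartesian_product_def)
    with step.IH show ?case
      using a step.hyps by (auto intro: rtrancl_on_into_rtrancl_on)
  qed
  \<comment> \<open>Induction along a walk in \<open>A\<close> from \<open>u\<close>. The endpoint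
    \<open>k\<close> stays arbitrary, because the induction hypothesis is applied at a crossing
    point, not at the given endpoint.\<close>
  have "((u, h), (v, k)) \<in> ?R" if "u \<in> A" "v \<in> A" and h: "h \<in> B u" and k: "k \<in> B v" for u v h k
    using A_conn[OF that(1,2)] k
  proof (induction arbitrary: k rule: rtrancl_on_induct)
    case base
    then show ?case using fibre h by blast
  next
    case (step y z)
    \<comment> \<open>The arc from \<open>y\<close> to \<open>z\<close> is crossed at a height
      \<open>m\<close> common to both fibres; the rest of the way to \<open>k\<close> runs in the
      fibre over \<open>z\<close>.\<close>
    obtain m where m: "m \<in> B y" "m \<in> B z"
      using meet \<open>y \<in> A\<close> \<open>z \<in> A\<close> by blast
    have "((y, m), (z, m)) \<in> parcs (G \<box> H)"
      using step.hyps m A_sub B_sub by (auto simp: cartesian_product_def)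
    with step.IH[OF m(1)] have "((u, h), (z, m)) \<in> ?R"
      using m \<open>z \<in> A\<close> by (auto intro: rtrancl_on_into_rtrancl_on)
    then show ?case
      using fibre[OF \<open>z \<in> A\<close> m(2) step.prems] by (rule rtrancl_on_trans)
  qed
  moreover have "?W \<subseteq> pverts (G \<box> H)"
    using A_sub B_sub by (fastforce simp: cartesian_product_def)
  moreover have "?W \<noteq> {}"
    using A_ne B_ne by blast
  ultimately show ?thesis
    unfolding connected_set_iff[OF pair_graph_cartesian_product[OF assms(1,2)]] by blast
qed

text \<open>\<open>Sigma A B\<close> depends only on the values of \<open>B\<close> on
  \<open>A\<close>; the constant choices of \<open>B\<close> give the boxes.\<close>

definition bramble_product :: "'a set set \<Rightarrow> 'b set set \<Rightarrow> ('a \<times> 'b) set set" where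
  "bramble_product \<S> \<T> = {Sigma A B | A B. A \<in> \<S> \<and> (\<forall>a\<in>A. B a \<in> \<T>)}"

lemma strict_bramble_product:
  assumes "pair_graph G" "pair_graph H"
    and S: "strict_bramble G \<S>" and T: "strict_bramble H \<T>"
  shows "strict_bramble (G \<box> H) (bramble_product \<S> \<T>)"
  unfolding strict_bramble_def
proof (intro conjI ballI)
  fix W assume "W \<in> bramble_product \<S> \<T>"
  then obtain A B where W: "W = Sigma A B" and A: "A \<in> \<S>" and B: "\<And>a. a \<in> A \<Longrightarrow> B a \<in> \<T>"
    by (auto simp: bramble_product_def)
  have "A \<noteq> {}" "connected_set G A"
    using S A by (auto simp: strict_bramble_def)
  moreover have "B a \<noteq> {}" "connected_set H (B a)" if "a \<in> A" for a
    using T B[OF that] by (auto simp: strict_bramble_def)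
  moreover have "B a \<inter> B a' \<noteq> {}" if "a \<in> A" "a' \<in> A" for a a'
    using T B that unfolding strict_bramble_def by blast
  ultimately show "W \<noteq> {}" "connected_set (G \<box> H) W"
    unfolding W using connected_set_Sigma[OF assms(1,2)] by blast+
  fix W' assume "W' \<in> bramble_product \<S> \<T>"
  then obtain A' B' where W': "W' = Sigma A' B'" and A': "A' \<in> \<S>"
    and B': "\<And>a. a \<in> A' \<Longrightarrow> B' a \<in> \<T>"
    by (auto simp: bramble_product_def)
  obtain a where a: "a \<in> A" "a \<in> A'"
    using S A A' unfolding strict_bramble_def by blast
  obtain h where "h \<in> B a" "h \<in> B' a"
    using T B[OF a(1)] B'[OF a(2)] unfolding strict_bramble_def by blast
  with a show "W \<inter> W' \<noteq> {}"
    unfolding W W' by blast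
qed

lemma bramble_order_le:
  assumes "pair_graph G" "strict_bramble G \<S>" "hitting_set G \<S> S"
  shows "bramble_order G \<S> \<le> card S"
  unfolding bramble_order_def
  using assms by (intro Min_le hitting_set_cards) auto

lemma bramble_order_attained:
  assumes "pair_graph G" "strict_bramble G \<S>"
  obtains S where "hitting_set G \<S> S" "card S = bramble_order G \<S>"
  using Min_in[OF hitting_set_cards[OF assms]] unfolding bramble_order_def by force

lemma sbn_attained:
  assumes "pair_graph G"
  obtains \<S> where "strict_bramble G \<S>" "bramble_order G \<S> = sbn G"
  using Max_in[OF bramble_orders[OF assms]] unfolding sbn_def by force

lemma bramble_order_le_sbn:
  assumes "pair_graph G" "strict_bramble G \<S>"
  shows "bramble_order G \<S> \<le> sbn G"
  unfolding sbn_def using assms by (intro Max_ge bramble_orders) auto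

text \<open>In a minimum hitting set \<open>X\<close>, at least \<open>bramble_order G \<S>\<close>
  fibres hit \<open>\<T>\<close>, and each of these has at least \<open>bramble_order H \<T>\<close>
  points. Fibres over distinct vertices are disjoint, so the product bounds \<open>card X\<close>
  from below.\<close>

lemma bramble_order_product:
  assumes G: "pair_graph G" and H: "pair_graph H"
    and S: "strict_bramble G \<S>" and T: "strict_bramble H \<T>"
  shows "bramble_order G \<S> * bramble_order H \<T> \<le> bramble_order (G \<box> H) (bramble_product \<S> \<T>)"
proof -
  interpret GH: pair_graph "G \<box> H"
    using G H by (rule pair_graph_cartesian_product)
  obtain X where X: "hitting_set (G \<box> H) (bramble_product \<S> \<T>) X"
    and card_X: "card X = bramble_order (G \<box> H) (bramble_product \<S> \<T>)"
    using bramble_order_attained[OF GH.pair_graph_axioms strict_bramble_product[OF assms]] .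
  have X_sub: "X \<subseteq> pverts G \<times> pverts H"
    using X by (simp add: hitting_set_def cartesian_product_def)
  have fin_X: "finite X"
    using X GH.pair_finite_verts by (auto simp: hitting_set_def intro: finite_subset)
  then have fin_fibre: "finite (X `` {a})" for a
    by (rule finite_Image)
  define Y where "Y = {a \<in> pverts G. hitting_set H \<T> (X `` {a})}"
  have fin_Y: "finite Y"
    using pair_graph.axioms(1)[OF G]
    by (simp add: Y_def pair_fin_digraph.pair_finite_verts pair_digraph.axioms)
  have "hitting_set G \<S> Y"
    unfolding hitting_set_def
  proof (intro conjI ballI notI)
    show "Y \<subseteq> pverts G" by (auto simp: Y_def)
    fix A assume A: "A \<in> \<S>" and "Y \<inter> A = {}"
    have "A \<subseteq> pverts G"
      using S A by (auto simp: strict_bramble_def connected_set_def)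
    with \<open>Y \<inter> A = {}\<close> have "\<forall>a\<in>A. \<not> hitting_set H \<T> (X `` {a})"
      by (auto simp: Y_def)
    \<comment> \<open>By \<open>X_sub\<close> the fibre lies in \<open>pverts H\<close>, so it can
      fail to be a hitting set only by missing an element of \<open>\<T>\<close>.\<close>
    then have "\<forall>a\<in>A. \<exists>B\<in>\<T>. X `` {a} \<inter> B = {}"
      using X_sub unfolding hitting_set_def by blast
    then obtain B where B: "\<And>a. a \<in> A \<Longrightarrow> B a \<in> \<T>" "\<And>a. a \<in> A \<Longrightarrow> X `` {a} \<inter> B a = {}"
      by metis
    have "Sigma A B \<in> bramble_product \<S> \<T>"
      using A B(1) by (auto simp: bramble_product_def)
    then have "X \<inter> Sigma A B \<noteq> {}"
      using X by (simp add: hitting_set_def)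
    with B(2) show False by blast
  qed
  then have "bramble_order G \<S> \<le> card Y"
    by (rule bramble_order_le[OF G S])
  then have "bramble_order G \<S> * bramble_order H \<T> \<le> card Y * bramble_order H \<T>"
    by (rule mult_right_mono) simp
  also have "\<dots> = (\<Sum>a\<in>Y. bramble_order H \<T>)"
    by simp
  also have "\<dots> \<le> (\<Sum>a\<in>Y. card (X `` {a}))"
    by (intro sum_mono bramble_order_le[OF H T]) (simp add: Y_def)
  \<comment> \<open>The sigma set is the part of \<open>X\<close> lying over
    \<open>Y\<close>.\<close>
  also have "\<dots> = card (SIGMA a:Y. X `` {a})"
    using fin_Y fin_fibre by simp
  also have "\<dots> \<le> card X"
    using fin_X by (rule card_mono) auto
  finally show ?thesis by (simp add: card_X)
qed

theorem theorem8:
  fixes G :: "'a pair_pre_digraph" and H :: "'b pair_pre_digraph"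
  assumes "pair_graph G" and "pair_graph H"
  shows "sbn (G \<box> H) \<ge> sbn G * sbn H"
proof -
  obtain \<S> where S: "strict_bramble G \<S>" "bramble_order G \<S> = sbn G"
    using sbn_attained[OF assms(1)] .
  obtain \<T> where T: "strict_bramble H \<T>" "bramble_order H \<T> = sbn H"
    using sbn_attained[OF assms(2)] .
  have "sbn G * sbn H \<le> bramble_order (G \<box> H) (bramble_product \<S> \<T>)"
    using bramble_order_product[OF assms S(1) T(1)] S(2) T(2) by simp
  also have "\<dots> \<le> sbn (G \<box> H)"
    by (intro bramble_order_le_sbn pair_graph_cartesian_product strict_bramble_product assms S(1) T(1))
  finally show ?thesis .
qed

end
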